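(* Let $X\subseteq B^h$, let $G=Q_h(X)$, and let $\hat x=\bigwedge_{x\in\widehat X} x$. Then a vertex $v$ of $G$ is a minimal vertex of $G$ if and only if $v\in\bigcap_{x\in\widehat X} I_G(0^h,x)$; moreover $\bigcap_{x\in\widehat X} I_G(0^h,x)=I_G(0^h,\hat x)$.
   Context: $B=\{0,1\}$, $B^h$ is the set of binary words of length $h$, $Q_h$ is the hypercube on $B^h$ (adjacent iff Hamming distance $1$), $0^h$ is the all-zero word, and $\wedge$ denotes bitwise AND. For $u,v\in B^h$, $u\le v$ means $u_i\le v_i$ for all $i$. For $X\subseteq B^h$, $\widehat X$ is the set of maximal elements of $(X,\le)$, and the daisy cube $Q_h(X)$ (of order $h$) is the subgraph of $Q_h$ induced by $\{v\in B^h: v\le x\text{ for some }x\in X\}$. For a connected graph $G$ and vertices $a,b$, $I_G(a,b)$ is the set of vertices lying on shortest $a,b$-paths in $G$. An isometric embedding of $G$ into $Q_h$ is a map $\alpha:V(G)\to B^h$ preserving distances (graph distance = Hamming distance). For a graph $G$ isomorphic to a daisy cube of order $h$, an isometric embedding $\alpha$ into $Q_h$ is proper if $G$ is isomorphic to $Q_h(\alpha(V(G)))$. A vertex $v$ of $G$ is a minimal vertex of $G$ if there is a proper embedding $\alpha$ of $G$ into $Q_h$ with $\alpha(v)=0^h$. *)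

theory Defs
  imports "Graph_Theory.Graph_Theory"
begin

section \<open>Binary words\<close>

type_synonym bword = "bool list"

definition words :: "nat \<Rightarrow> bword set" where
  "words h = {w. length w = h}"

definition zero_word :: "nat \<Rightarrow> bword" where
  "zero_word h = replicate h False"

text \<open>The order on \<^typ>\<open>bool\<close> is \<^prop>\<open>False \<le> True\<close>, so this is the coordinatewise order.\<close>

definition word_le :: "bword \<Rightarrow> bword \<Rightarrow> bool" where
  "word_le u v = list_all2 (\<le>) u v"

definition hamming :: "bword \<Rightarrow> bword \<Rightarrow> nat" where
  "hamming u v = card {i. i < length u \<and> u ! i \<noteq> v ! i}"

definition max_words :: "bword set \<Rightarrow> bword set" where
  "max_words X = {x \<in> X. \<forall>y\<in>X. word_le x y \<longrightarrow> y = x}"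

text \<open>The bitwise conjunction of a set of words of length \<open>h\<close>; for the empty set it is the
  all-one word.\<close>

definition big_and :: "nat \<Rightarrow> bword set \<Rightarrow> bword" where
  "big_and h Y = map (\<lambda>i. \<forall>y\<in>Y. y ! i) [0..<h]"

section \<open>Distance and intervals\<close>

text \<open>Undirected graphs are symmetric digraphs.  All arcs have cost 1, so \<open>\<mu>\<close> is the usual
  distance (and is infinite between vertices in different components).\<close>

definition gdist :: "('a, 'b) pre_digraph \<Rightarrow> 'a \<Rightarrow> 'a \<Rightarrow> ereal" where
  "gdist G u v = wf_digraph.\<mu> G (\<lambda>_. 1) u v"

definition shortest_path :: "('a, 'b) pre_digraph \<Rightarrow> 'a \<Rightarrow> 'b list \<Rightarrow> 'a \<Rightarrow> bool" where
  "shortest_path G a p b \<longleftrightarrow> pre_digraph.apath G a p b \<and> ereal (real (length p)) = gdist G a b"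

definition interval :: "('a, 'b) pre_digraph \<Rightarrow> 'a \<Rightarrow> 'a \<Rightarrow> 'a set" where
  "interval G a b = {v. \<exists>p. shortest_path G a p b \<and> v \<in> set (pre_digraph.awalk_verts G a p)}"

section \<open>Hypercubes and daisy cubes\<close>

definition hypercube :: "nat \<Rightarrow> (bword, bword \<times> bword) pre_digraph" where
  "hypercube h = \<lparr> verts = words h,
     arcs = {(u, v). u \<in> words h \<and> v \<in> words h \<and> hamming u v = 1},
     tail = fst, head = snd \<rparr>"

definition daisy_cube :: "nat \<Rightarrow> bword set \<Rightarrow> (bword, bword \<times> bword) pre_digraph" where
  "daisy_cube h X = hypercube h \<restriction> {v \<in> words h. \<exists>x\<in>X. word_le v x}"

lemma hamming_commute: "length u = length v \<Longrightarrow> hamming u v = hamming v u"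
  unfolding hamming_def by (rule arg_cong[where f = card]) auto

lemma finite_words: "finite (words h)"
  using finite_lists_length_eq[of "UNIV :: bool set" h] by (simp add: words_def)

lemma graph_hypercube: "graph (hypercube h)"
proof -
  have "finite {(u, v). u \<in> words h \<and> v \<in> words h \<and> hamming u v = 1}"
    by (rule finite_subset[of _ "words h \<times> words h"]) (auto simp: finite_words)
  moreover have "symmetric (hypercube h)"
    by (auto simp: symmetric_def sym_def arcs_ends_conv hypercube_def words_def image_iff
        hamming_commute)
  ultimately show ?thesis
    by unfold_locales
      (auto simp: hypercube_def finite_words hamming_def arc_to_ends_def)
qed

lemma graph_daisy_cube: "graph (daisy_cube h X)"
proof -
  interpret graph "hypercube h" by (rule graph_hypercube)
  have induced: "induced_subgraph (daisy_cube h X) (hypercube h)"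
    unfolding daisy_cube_def by (rule induced_induce) (auto simp: hypercube_def)
  then have "symmetric (daisy_cube h X)"
    by (rule induced_graph_imp_symmetric[OF sym_arcs])
  with digraphI_induced[OF induced] show ?thesis by (rule digraph.graphI)
qed

section \<open>Minimal vertices\<close>

definition isometric_embedding ::
  "nat \<Rightarrow> ('a, 'b) pre_digraph \<Rightarrow> ('a \<Rightarrow> bword) \<Rightarrow> bool" where
  "isometric_embedding h G \<alpha> \<longleftrightarrow> \<alpha> ` verts G \<subseteq> words h \<and>
     (\<forall>u\<in>verts G. \<forall>v\<in>verts G. gdist G u v = ereal (real (hamming (\<alpha> u) (\<alpha> v))))"

text \<open>The isomorphism is not required to be induced by \<open>\<alpha>\<close>.\<close>

definition proper_embedding ::
  "nat \<Rightarrow> ('a, 'b) pre_digraph \<Rightarrow> ('a \<Rightarrow> bword) \<Rightarrow> bool" where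
  "proper_embedding h G \<alpha> \<longleftrightarrow>
     isometric_embedding h G \<alpha> \<and> digraph_iso G (daisy_cube h (\<alpha> ` verts G))"

text \<open>If a proper embedding exists, \<open>G\<close> is isomorphic to a daisy cube of order \<open>h\<close>.\<close>

definition minimal_vertex :: "nat \<Rightarrow> ('a, 'b) pre_digraph \<Rightarrow> 'a \<Rightarrow> bool" where
  "minimal_vertex h G v \<longleftrightarrow>
     v \<in> verts G \<and> (\<exists>\<alpha>. proper_embedding h G \<alpha> \<and> \<alpha> v = zero_word h)"

end

(* A daisy cube is an isometric subgraph of the hypercube, so its intervals are the hypercube
   intervals cut down to its vertices; in particular I(0,x) consists of the vertices below x.
   If v lies below every maximal x, then adding v bitwise preserves each cube [0,x], hence the
   vertex set, and it maps v to 0.  Conversely, let \<alpha> be a proper embedding with \<alpha>(v) = 0.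
   Counting vertices, its image is a down-set, so the interval between \<alpha>(v) and \<alpha>(x) has
   2^d(v,x) elements.  Pulling it back, the whole hypercube interval between v and x belongs to
   the daisy cube; this includes the join of v and x, and if x is maximal then v \<le> x. *)
theory Submission
  imports Defs
begin

section \<open>Coordinatewise order, Hamming metric, subcubes and translations\<close>

section \<open>Words and Hamming intervals\<close>

lemma word_le_iff:
  assumes "u \<in> words h" "v \<in> words h"
  shows "word_le u v \<longleftrightarrow> (\<forall>i<h. u ! i \<longrightarrow> v ! i)"
  using assms by (auto simp: word_le_def words_def list_all2_conv_all_nth)

lemma word_le_refl [simp]: "word_le u u"
  by (simp add: word_le_def list_all2_refl)

lemma word_eqI:
  assumes "u \<in> words h" "v \<in> words h" "\<And>i. i < h \<Longrightarrow> u ! i = v ! i"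
  shows "u = v"
  using assms by (auto simp: words_def intro: nth_equalityI)

lemma zero_word_in_words [simp]: "zero_word h \<in> words h"
  by (simp add: zero_word_def words_def)

lemma zero_word_nth [simp]: "i < h \<Longrightarrow> \<not> zero_word h ! i"
  by (simp add: zero_word_def)

lemma hamming_words: "u \<in> words h \<Longrightarrow> hamming u v = card {i. i < h \<and> u ! i \<noteq> v ! i}"
  by (simp add: hamming_def words_def)

lemma hamming_eq_0_iff:
  assumes "u \<in> words h" "v \<in> words h"
  shows "hamming u v = 0 \<longleftrightarrow> u = v"
  using assms by (auto simp: hamming_words intro: word_eqI)

lemma hamming_zero_le: "u \<in> words h \<Longrightarrow> hamming (zero_word h) u \<le> h"
  using card_mono[of "{..<h}" "{i. i < h \<and> zero_word h ! i \<noteq> u ! i}"]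
  by (auto simp: hamming_words[OF zero_word_in_words])

text \<open>Metric betweenness in the whole hypercube: on words of length \<open>h\<close>,
  \<open>v\<close> lies in the interval from \<open>u\<close> to \<open>w\<close>. The
  coordinatewise form makes counting and joins easy.\<close>

definition between :: "nat \<Rightarrow> bword \<Rightarrow> bword \<Rightarrow> bword \<Rightarrow> bool" where
  "between h u v w \<longleftrightarrow> (\<forall>i<h. v ! i = u ! i \<or> v ! i = w ! i)"

lemma between_zero_iff:
  assumes "v \<in> words h" "w \<in> words h"
  shows "between h (zero_word h) v w \<longleftrightarrow> word_le v w"
  using assms by (auto simp: word_le_iff between_def)

text \<open>The difference sets \<open>?D u v\<close> and \<open>?D v w\<close> together cover
  \<open>?D u w\<close>. Equality of the distances forces them to be disjoint, and a common
  coordinate is exactly one where \<open>v\<close> differs from both ends.\<close>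

lemma
  assumes "u \<in> words h" "v \<in> words h" "w \<in> words h"
  shows hamming_triangle: "hamming u w \<le> hamming u v + hamming v w"
    and hamming_add_eq_iff: "hamming u v + hamming v w = hamming u w \<longleftrightarrow> between h u v w"
proof -
  let ?D = "\<lambda>u v :: bword. {i. i < h \<and> u ! i \<noteq> v ! i}"
  have fin: "finite (?D a b)" for a b
    by simp
  have sum: "hamming u v + hamming v w = card (?D u v \<union> ?D v w) + card (?D u v \<inter> ?D v w)"
    using card_Un_Int[OF fin fin] assms by (simp add: hamming_words)
  have sub: "?D u w \<subseteq> ?D u v \<union> ?D v w"
    by auto
  have le: "hamming u w \<le> card (?D u v \<union> ?D v w)"
    using card_mono[OF _ sub] assms by (simp add: hamming_words)
  then show "hamming u w \<le> hamming u v + hamming v w"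
    using sum by simp
  show "hamming u v + hamming v w = hamming u w \<longleftrightarrow> between h u v w"
  proof
    assume "hamming u v + hamming v w = hamming u w"
    then have "card (?D u v \<inter> ?D v w) = 0"
      using sum le by linarith
    then have "?D u v \<inter> ?D v w = {}"
      by simp
    then show "between h u v w"
      by (auto simp: between_def)
  next
    assume btw: "between h u v w"
    then have "?D u v \<inter> ?D v w = {}"
      by (auto simp: between_def)
    moreover have "?D u v \<union> ?D v w = ?D u w"
      using btw by (auto simp: between_def)
    ultimately show "hamming u v + hamming v w = hamming u w"
      using sum assms by (simp add: hamming_words)
  qed
qed

lemma hamming_flip:
  assumes "u \<in> words h" "i < h" "u ! i \<noteq> v ! i"
  shows "hamming u v = Suc (hamming (u[i := v ! i]) v)" "hamming u (u[i := v ! i]) = 1"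
proof -
  have len: "length u = h"
    using assms by (simp add: words_def)
  have "{j. j < h \<and> u ! j \<noteq> v ! j} = insert i {j. j < h \<and> u[i := v ! i] ! j \<noteq> v ! j}"
    using assms len by (auto simp: nth_list_update)
  then show "hamming u v = Suc (hamming (u[i := v ! i]) v)"
    using len assms by (simp add: hamming_def)
  have "{j. j < h \<and> u ! j \<noteq> u[i := v ! i] ! j} = {i}"
    using assms len by (auto simp: nth_list_update)
  then show "hamming u (u[i := v ! i]) = 1"
    using len by (simp add: hamming_def)
qed

text \<open>A word between \<open>v\<close> and \<open>w\<close> is determined by where it departs
  from \<open>v\<close>, and this can be any subset of the coordinates where \<open>v\<close> and
  \<open>w\<close> differ.\<close>

lemma card_between:
  assumes "v \<in> words h" "w \<in> words h"
  shows "card {u \<in> words h. between h v u w} = 2 ^ hamming v w"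
proof -
  let ?f = "\<lambda>u :: bword. {i. i < h \<and> u ! i \<noteq> v ! i}"
  let ?S = "{u \<in> words h. between h v u w}"
  let ?T = "{i. i < h \<and> v ! i \<noteq> w ! i}"
  have inj: "inj_on ?f ?S"
  proof (rule inj_onI)
    fix a b assume ab: "a \<in> ?S" "b \<in> ?S" "?f a = ?f b"
    have "a ! i = b ! i" if "i < h" for i
    proof -
      have "i \<in> ?f a \<longleftrightarrow> i \<in> ?f b"
        by (simp only: ab(3))
      then show ?thesis
        using that by auto
    qed
    then show "a = b"
      using ab(1,2) by (intro word_eqI[of a h b]) simp_all
  qed
  have image: "?f ` ?S = Pow ?T"
  proof (intro equalityI subsetI)
    fix A assume "A \<in> ?f ` ?S"
    then show "A \<in> Pow ?T"
      by (auto simp: between_def)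
  next
    fix A assume A: "A \<in> Pow ?T"
    define u where "u = map (\<lambda>i. if i \<in> A then w ! i else v ! i) [0..<h]"
    have "u \<in> ?S" "?f u = A"
      using A by (auto simp: u_def words_def between_def)
    then show "A \<in> ?f ` ?S"
      by blast
  qed
  have "card ?S = card (Pow ?T)"
    using card_image[OF inj] by (simp only: image)
  then show ?thesis
    using assms by (simp add: card_Pow hamming_words)
qed

text \<open>Translation by \<open>v\<close> is the hypercube automorphism moving \<open>v\<close> to
  the origin; it supplies the embedding in \<open>minimal_vertexI\<close>.\<close>

definition word_xor :: "bword \<Rightarrow> bword \<Rightarrow> bword" where
  "word_xor u v = map2 (\<noteq>) u v"

lemma word_xor_in_words: "u \<in> words h \<Longrightarrow> v \<in> words h \<Longrightarrow> word_xor u v \<in> words h"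
  by (simp add: word_xor_def words_def)

lemma word_xor_nth:
  "u \<in> words h \<Longrightarrow> v \<in> words h \<Longrightarrow> i < h \<Longrightarrow> word_xor u v ! i \<longleftrightarrow> u ! i \<noteq> v ! i"
  by (simp add: word_xor_def words_def)

lemma word_xor_self: "u \<in> words h \<Longrightarrow> word_xor u u = zero_word h"
  by (rule word_eqI[of _ h]) (simp_all add: word_xor_in_words word_xor_nth)

lemma word_xor_cancel:
  assumes "u \<in> words h" "v \<in> words h"
  shows "word_xor u (word_xor u v) = v"
  using assms by (intro word_eqI[of _ h]) (auto simp: word_xor_in_words word_xor_nth)

lemma hamming_word_xor:
  assumes "u \<in> words h" "v \<in> words h" "w \<in> words h"
  shows "hamming (word_xor w u) (word_xor w v) = hamming u v"
proof -
  have "{i. i < h \<and> word_xor w u ! i \<noteq> word_xor w v ! i} = {i. i < h \<and> u ! i \<noteq> v ! i}"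
    using assms by (auto simp: word_xor_nth)
  then show ?thesis
    using assms by (simp add: hamming_words[of _ h] word_xor_in_words)
qed

section \<open>Isometry of daisy cubes in the hypercube, and their intervals\<close>

section \<open>Distances and intervals in daisy cubes\<close>

lemma verts_daisy_cube: "verts (daisy_cube h X) = {v \<in> words h. \<exists>x\<in>X. word_le v x}"
  by (simp add: daisy_cube_def)

lemma daisy_cube_simps:
  "arcs (daisy_cube h X) =
    {(u, v). u \<in> verts (daisy_cube h X) \<and> v \<in> verts (daisy_cube h X) \<and> hamming u v = 1}"
  "tail (daisy_cube h X) = fst" "head (daisy_cube h X) = snd"
  by (auto simp: daisy_cube_def hypercube_def induce_subgraph_def)

lemma verts_daisy_cube_down:
  assumes "X \<subseteq> words h" "v \<in> verts (daisy_cube h X)" "u \<in> words h" "word_le u v"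
  shows "u \<in> verts (daisy_cube h X)"
proof -
  obtain x where x: "x \<in> X" "word_le v x" "v \<in> words h"
    using assms by (auto simp: verts_daisy_cube)
  then have "word_le u x"
    using assms by (auto simp: word_le_iff[of _ h] subset_iff)
  then show ?thesis
    using x assms by (auto simp: verts_daisy_cube)
qed

lemma (in wf_digraph) awalk_cost_1: "awalk_cost (\<lambda>_. 1) p = real (length p)"
  by (induct p) simp_all

text \<open>Each arc changes one coordinate, so the triangle inequality can be iterated along the
  walk.\<close>

lemma hamming_le_length_awalk:
  assumes "pre_digraph.awalk (daisy_cube h X) u p v"
  shows "hamming u v \<le> length p"
proof -
  interpret graph "daisy_cube h X"
    by (rule graph_daisy_cube)
  show ?thesis
    using assms
  proof (induct p arbitrary: u)
    case Nil
    then show ?case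
      by (auto simp: awalk_Nil_iff hamming_def)
  next
    case (Cons e p)
    then obtain w where e: "e = (u, w)" "u \<in> words h" "w \<in> words h" "hamming u w = 1"
        and p: "awalk w p v"
      by (cases e) (auto simp: awalk_Cons_iff daisy_cube_simps verts_daisy_cube)
    have "v \<in> words h"
      using awalk_last_in_verts[OF p] by (simp add: verts_daisy_cube)
    then have "hamming u v \<le> hamming u w + hamming w v"
      using e by (intro hamming_triangle)
    then show ?case
      using Cons(1)[OF p] e by simp
  qed
qed

text \<open>The other half of the isometry: differing coordinates are flipped one at a time, in an
  order that keeps every intermediate word below \<open>u\<close> or below \<open>v\<close>.\<close>

lemma exists_awalk_length_hamming:
  assumes X: "X \<subseteq> words h"
    and "u \<in> verts (daisy_cube h X)" "v \<in> verts (daisy_cube h X)"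
  shows "\<exists>p. pre_digraph.awalk (daisy_cube h X) u p v \<and> length p = hamming u v"
proof -
  interpret graph "daisy_cube h X"
    by (rule graph_daisy_cube)
  have "\<exists>p. awalk u p v \<and> length p = n" if "hamming u v = n" "u \<in> verts (daisy_cube h X)" for n
    using that
  proof (induct n arbitrary: u)
    case 0
    then have "u = v"
      using hamming_eq_0_iff[of u h v] assms by (simp add: verts_daisy_cube)
    then show ?case
      using assms by (auto simp: awalk_Nil_iff)
  next
    case (Suc n)
    have words: "u \<in> words h" "v \<in> words h"
      using Suc assms by (auto simp: verts_daisy_cube)
    \<comment> \<open>Descend to the meet of \<open>u\<close> and \<open>v\<close> before ascending, so as not to leave the down-set.\<close>
    obtain i where i: "i < h" "u ! i \<noteq> v ! i"
        and in_verts: "u[i := v ! i] \<in> verts (daisy_cube h X)"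
    proof (cases "word_le u v")
      case True
      have "u \<noteq> v"
        using Suc(2) hamming_eq_0_iff[OF words] by auto
      then obtain i where i: "i < h" "u ! i \<noteq> v ! i"
        using word_eqI[OF words] by blast
      have "u[i := v ! i] \<in> words h"
        using words by (simp add: words_def)
      moreover from this have "word_le (u[i := v ! i]) v"
        using True i(1) words
        by (auto simp: word_le_iff[of _ h] words_def nth_list_update split: if_splits)
      ultimately show ?thesis
        using that i verts_daisy_cube_down[OF X assms(3)] by blast
    next
      case False
      then obtain i where i: "i < h" "u ! i" "\<not> v ! i"
        using words by (auto simp: word_le_iff)
      have "u[i := v ! i] \<in> words h"
        using words by (simp add: words_def)
      moreover from this have "word_le (u[i := v ! i]) u"
        using i words by (auto simp: word_le_iff[of _ h] words_def nth_list_update)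
      ultimately show ?thesis
        using that i verts_daisy_cube_down[OF X Suc(3)] by blast
    qed
    let ?u = "u[i := v ! i]"
    have "hamming ?u v = n"
      using hamming_flip(1)[OF words(1) i] Suc(2) by simp
    then obtain p where p: "awalk ?u p v" "length p = n"
      using Suc(1) in_verts by blast
    have "awalk u ((u, ?u) # p) v"
      using p in_verts Suc(3) hamming_flip(2)[OF words(1) i]
      by (simp add: awalk_Cons_iff daisy_cube_simps)
    then show ?case
      using p by (intro exI[of _ "(u, ?u) # p"]) simp
  qed
  then show ?thesis
    using assms by blast
qed

lemma gdist_daisy_cube:
  assumes "X \<subseteq> words h" "u \<in> verts (daisy_cube h X)" "v \<in> verts (daisy_cube h X)"
  shows "gdist (daisy_cube h X) u v = ereal (real (hamming u v))"
proof -
  interpret graph "daisy_cube h X"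
    by (rule graph_daisy_cube)
  obtain p where p: "awalk u p v" "length p = hamming u v"
    using exists_awalk_length_hamming[OF assms] by blast
  have "\<mu> (\<lambda>_. 1) u v \<le> ereal (real (hamming u v))"
    using min_cost_le_walk_cost[OF p(1), of "\<lambda>_. 1"] p(2) by (simp add: awalk_cost_1)
  moreover have "ereal (real (hamming u v)) \<le> \<mu> (\<lambda>_. 1) u v"
    unfolding \<mu>_def by (rule INF_greatest) (auto simp: awalk_cost_1 hamming_le_length_awalk)
  ultimately show ?thesis
    by (simp add: gdist_def)
qed

text \<open>Cutting a closed piece out of a walk with a repeated vertex would leave a walk shorter
  than the Hamming distance.\<close>

lemma awalk_length_hamming_imp_apath:
  assumes "pre_digraph.awalk (daisy_cube h X) u p v" "length p = hamming u v"
  shows "pre_digraph.apath (daisy_cube h X) u p v"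
proof -
  interpret graph "daisy_cube h X"
    by (rule graph_daisy_cube)
  have "distinct (awalk_verts u p)"
  proof (rule ccontr)
    assume "\<not> ?thesis"
    then obtain q r s w where "p = q @ r @ s" "0 < length r" "awalk u q w" "awalk w s v"
      using awalk_not_distinct_decomp[OF assms(1)] by blast
    moreover from this have "hamming u v \<le> length (q @ s)"
      by (intro hamming_le_length_awalk[of h X]) (rule awalk_appendI)
    ultimately show False
      using assms(2) by (simp flip: length_greater_0_conv)
  qed
  then show ?thesis
    using assms(1) by (simp add: apath_def)
qed

lemma interval_daisy_cube:
  assumes X: "X \<subseteq> words h"
    and ab: "a \<in> verts (daisy_cube h X)" "b \<in> verts (daisy_cube h X)"
  shows "interval (daisy_cube h X) a b = {v \<in> verts (daisy_cube h X). between h a v b}"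
proof -
  interpret graph "daisy_cube h X"
    by (rule graph_daisy_cube)
  have words: "v \<in> words h" if "v \<in> verts (daisy_cube h X)" for v
    using that by (simp add: verts_daisy_cube)
  show ?thesis
  proof (intro equalityI subsetI)
    fix v assume "v \<in> interval (daisy_cube h X) a b"
    then obtain p where p: "awalk a p b" "length p = hamming a b" "v \<in> set (awalk_verts a p)"
      using gdist_daisy_cube[OF assms]
      by (auto simp: interval_def shortest_path_def apath_def)
    then obtain q r where qr: "p = q @ r" "awalk a q v" "awalk v r b"
      using awalk_decomp by blast
    then have v: "v \<in> verts (daisy_cube h X)"
      by blast
    \<comment> \<open>The two pieces are at least as long as the Hamming distances of their ends,
      and their lengths add up to \<open>hamming a b\<close>.\<close>
    have "hamming a v + hamming v b \<le> hamming a b"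
      using hamming_le_length_awalk[OF qr(2)] hamming_le_length_awalk[OF qr(3)] p qr by simp
    then have "hamming a v + hamming v b = hamming a b"
      using hamming_triangle[of a h v b] words ab v by (simp add: order_antisym)
    then show "v \<in> {v \<in> verts (daisy_cube h X). between h a v b}"
      using hamming_add_eq_iff[of a h v b] words ab v by simp
  next
    fix v assume "v \<in> {v \<in> verts (daisy_cube h X). between h a v b}"
    then have v: "v \<in> verts (daisy_cube h X)" and "hamming a v + hamming v b = hamming a b"
      using hamming_add_eq_iff[of a h v b] words ab by auto
    moreover obtain q where q: "awalk a q v" "length q = hamming a v"
      using exists_awalk_length_hamming[OF X ab(1) v] by blast
    moreover obtain r where r: "awalk v r b" "length r = hamming v b"
      using exists_awalk_length_hamming[OF X v ab(2)] by blast
    ultimately have "awalk a (q @ r) b" "length (q @ r) = hamming a b"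
      by (auto intro: awalk_appendI)
    then have "shortest_path (daisy_cube h X) a (q @ r) b"
      using awalk_length_hamming_imp_apath gdist_daisy_cube[OF assms]
      by (simp only: shortest_path_def)
    moreover have "v \<in> set (awalk_verts a (q @ r))"
      using set_awalk_verts_append[OF q(1) r(1)] hd_in_awalk_verts(1)[OF r(1)] by simp
    ultimately show "v \<in> interval (daisy_cube h X) a b"
      unfolding interval_def by blast
  qed
qed

text \<open>Serves the empty daisy cube, where the meet of the maximal words is not a
  vertex.\<close>

lemma interval_daisy_cube_not_in_verts:
  assumes "b \<notin> verts (daisy_cube h X)"
  shows "interval (daisy_cube h X) a b = {}"
proof -
  interpret graph "daisy_cube h X"
    by (rule graph_daisy_cube)
  show ?thesis
    using assms by (auto simp: interval_def shortest_path_def apath_def)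
qed

lemma interval_daisy_cube_zero:
  assumes "X \<subseteq> words h" "x \<in> verts (daisy_cube h X)"
  shows "interval (daisy_cube h X) (zero_word h) x = {v \<in> verts (daisy_cube h X). word_le v x}"
proof -
  have "word_le (zero_word h) x" and x: "x \<in> words h"
    using assms by (auto simp: word_le_iff[of _ h] verts_daisy_cube)
  then have "zero_word h \<in> verts (daisy_cube h X)"
    using verts_daisy_cube_down[OF assms] by simp
  then show ?thesis
    using interval_daisy_cube[of X h "zero_word h" x] assms x
    by (auto simp: between_zero_iff verts_daisy_cube)
qed

section \<open>Maximal generators and their meet\<close>

section \<open>Maximal words\<close>

lemma max_words_in_verts: "X \<subseteq> words h \<Longrightarrow> x \<in> max_words X \<Longrightarrow> x \<in> verts (daisy_cube h X)"
  unfolding max_words_def verts_daisy_cube using word_le_refl by blast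

text \<open>Among the words of \<open>X\<close> above \<open>v\<close>, one with the most ones is
  maximal in \<open>X\<close>.\<close>

lemma ex_max_word_above:
  assumes X: "X \<subseteq> words h" and v: "v \<in> verts (daisy_cube h X)"
  obtains x where "x \<in> max_words X" "word_le v x"
proof -
  obtain y where y: "y \<in> X" "word_le v y"
    using v by (auto simp: verts_daisy_cube)
  have v_word: "v \<in> words h"
    using v by (simp add: verts_daisy_cube)
  define P where "P y \<longleftrightarrow> y \<in> X \<and> word_le v y" for y
  obtain x where x: "P x"
    and greatest: "\<And>z. P z \<Longrightarrow> hamming (zero_word h) z \<le> hamming (zero_word h) x"
    \<comment> \<open>\<open>Suc h\<close> strictly bounds the number of ones in a word of length
      \<open>h\<close>.\<close>
    using ex_has_greatest_nat[of P y "hamming (zero_word h)" "Suc h"] y X hamming_zero_le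
    by (fastforce simp: P_def less_Suc_eq_le)
  have "z = x" if z: "z \<in> X" "word_le x z" for z
  proof -
    have words: "x \<in> words h" "z \<in> words h"
      using X x z by (auto simp: P_def)
    then have "word_le v z"
      using x z v_word by (auto simp: P_def word_le_iff[of _ h])
    then have "hamming (zero_word h) z \<le> hamming (zero_word h) x"
      using greatest z by (simp add: P_def)
    \<comment> \<open>Since \<open>x\<close> is between the origin and \<open>z\<close>, the weights
      differ by \<open>hamming x z\<close>, which must therefore vanish.\<close>
    moreover have "hamming (zero_word h) x + hamming x z = hamming (zero_word h) z"
      using words z hamming_add_eq_iff[of "zero_word h" h x z] by (simp add: between_zero_iff)
    ultimately show "z = x"
      using hamming_eq_0_iff[OF words] by simp
  qed
  then show thesis
    using that x by (auto simp: P_def max_words_def)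
qed

lemma big_and_in_words [simp]: "big_and h Y \<in> words h"
  by (simp add: big_and_def words_def)

lemma word_le_big_and_iff:
  assumes "v \<in> words h" "Y \<subseteq> words h"
  shows "word_le v (big_and h Y) \<longleftrightarrow> (\<forall>y\<in>Y. word_le v y)"
proof -
  have "big_and h Y ! i \<longleftrightarrow> (\<forall>y\<in>Y. y ! i)" if "i < h" for i
    using that by (simp add: big_and_def)
  then show ?thesis
    using assms by (auto simp: word_le_iff[of _ h] subset_iff)
qed

text \<open>For empty \<open>X\<close> the intersection over no intervals is the whole type, so it
  is cut down to the vertex set.\<close>

lemma Inter_interval_max_words:
  assumes X: "X \<subseteq> words h"
  shows "verts (daisy_cube h X) \<inter> (\<Inter>x\<in>max_words X. interval (daisy_cube h X) (zero_word h) x) =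
    {v \<in> verts (daisy_cube h X). \<forall>x\<in>max_words X. word_le v x}"
  using interval_daisy_cube_zero[OF X max_words_in_verts[OF X]] by auto

text \<open>If there are vertices, the meet lies below some maximal word and so is a vertex itself;
  its interval from the origin is then the set of vertices below it. Otherwise both sides are
  empty.\<close>

lemma interval_big_and_max_words:
  assumes X: "X \<subseteq> words h"
  shows "interval (daisy_cube h X) (zero_word h) (big_and h (max_words X)) =
    {v \<in> verts (daisy_cube h X). \<forall>x\<in>max_words X. word_le v x}"
proof -
  have max: "max_words X \<subseteq> words h"
    using X by (auto simp: max_words_def)
  show ?thesis
  proof (cases "verts (daisy_cube h X) = {}")
    case True
    then show ?thesis
      by (simp add: interval_daisy_cube_not_in_verts)
  next
    case False
    then obtain x where x: "x \<in> max_words X"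
      using ex_max_word_above[OF X] by blast
    have "word_le (big_and h (max_words X)) x"
      using word_le_big_and_iff[OF big_and_in_words[of h "max_words X"] max] x by simp
    then have "big_and h (max_words X) \<in> verts (daisy_cube h X)"
      using verts_daisy_cube_down[OF X max_words_in_verts[OF X x]] by simp
    then show ?thesis
      using interval_daisy_cube_zero[OF X] word_le_big_and_iff[OF _ max]
      by (auto simp: verts_daisy_cube)
  qed
qed

section \<open>The criterion: sufficiency by translation, necessity by counting\<close>

section \<open>Minimal vertices\<close>

text \<open>\<open>proper_embedding\<close> uses the daisy cube generated by an image; a down-set
  generates only itself.\<close>

lemma daisy_cube_verts_idem:
  assumes "X \<subseteq> words h"
  shows "daisy_cube h (verts (daisy_cube h X)) = daisy_cube h X"
proof -
  let ?V = "verts (daisy_cube h X)"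
  have "verts (daisy_cube h ?V) = ?V"
  proof (intro equalityI subsetI)
    fix v assume "v \<in> verts (daisy_cube h ?V)"
    then show "v \<in> ?V"
      using verts_daisy_cube_down[OF assms] by (auto simp: verts_daisy_cube[of h ?V])
  next
    fix v assume v: "v \<in> ?V"
    then have "v \<in> words h"
      by (simp add: verts_daisy_cube)
    then show "v \<in> verts (daisy_cube h ?V)"
      using v word_le_refl unfolding verts_daisy_cube[of h ?V] by blast
  qed
  then show ?thesis
    by (simp add: daisy_cube_def)
qed

lemma (in wf_digraph) digraph_iso_refl: "digraph_iso G G"
proof -
  define f where "f = \<lparr>iso_verts = id, iso_arcs = id, iso_head = head G, iso_tail = tail G\<rparr>"
  have "digraph_isomorphism f"
    by (simp add: f_def digraph_isomorphism_def wf_digraph_axioms)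
  moreover have "G = app_iso f G"
    by (simp add: f_def app_iso_def)
  ultimately show ?thesis
    unfolding digraph_iso_def by blast
qed

text \<open>The vertex count is all that the converse direction takes from the isomorphism.\<close>

lemma card_verts_digraph_iso:
  assumes "digraph_iso G H"
  shows "card (verts G) = card (verts H)"
  using assms
  by (auto simp: digraph_iso_def pre_digraph.digraph_isomorphism_def card_image)

text \<open>The witness is \<open>word_xor v\<close>. It permutes the vertices, so the isomorphism
  demanded by properness is the identity.\<close>

lemma minimal_vertexI:
  assumes X: "X \<subseteq> words h" and v: "v \<in> verts (daisy_cube h X)"
    and below: "\<And>x. x \<in> max_words X \<Longrightarrow> word_le v x"
  shows "minimal_vertex h (daisy_cube h X) v"
proof -
  let ?V = "verts (daisy_cube h X)"
  interpret graph "daisy_cube h X"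
    by (rule graph_daisy_cube)
  have words: "u \<in> words h" if "u \<in> ?V" for u
    using that by (simp add: verts_daisy_cube)
  have closed: "word_xor v u \<in> ?V" if u: "u \<in> ?V" for u
  proof -
    obtain x where x: "x \<in> max_words X" "word_le u x"
      using ex_max_word_above[OF X u] by blast
    have "x \<in> ?V"
      using x X max_words_in_verts by blast
    \<comment> \<open>Every 1 of \<open>word_xor v u\<close> is a 1 of \<open>v\<close> or of
      \<open>u\<close>, and both lie below \<open>x\<close>.\<close>
    moreover have "word_le (word_xor v u) x"
      using x(2) below[OF x(1)] words u v \<open>x \<in> ?V\<close>
      by (auto simp: word_le_iff[of _ h] word_xor_in_words word_xor_nth[of _ h])
    ultimately show ?thesis
      using verts_daisy_cube_down[OF X] word_xor_in_words words u v by blast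
  qed
  have image: "word_xor v ` ?V = ?V"
  proof (intro equalityI subsetI)
    fix u assume "u \<in> ?V"
    \<comment> \<open>\<open>word_xor v\<close> is an involution, so \<open>u\<close> is the image
      of \<open>word_xor v u\<close>.\<close>
    then show "u \<in> word_xor v ` ?V"
      using closed word_xor_cancel[of v h u] words v by (metis imageI)
  qed (use closed in blast)
  have "isometric_embedding h (daisy_cube h X) (word_xor v)"
    using image words v gdist_daisy_cube[OF X]
    by (auto simp: isometric_embedding_def hamming_word_xor[of _ h])
  moreover have "digraph_iso (daisy_cube h X) (daisy_cube h (word_xor v ` ?V))"
    using digraph_iso_refl by (simp add: image daisy_cube_verts_idem[OF X])
  ultimately show ?thesis
    using v word_xor_self words by (auto simp: minimal_vertex_def proper_embedding_def)
qed

text \<open>The image is contained in the down-set it generates, and the isomorphism makes these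
  finite sets equally large. Hence the image is a down-set.\<close>

lemma proper_embedding_image:
  assumes "finite (verts G)" "proper_embedding h G \<alpha>" "inj_on \<alpha> (verts G)"
  shows "\<alpha> ` verts G = verts (daisy_cube h (\<alpha> ` verts G))"
proof (rule card_subset_eq)
  show "finite (verts (daisy_cube h (\<alpha> ` verts G)))"
    by (simp add: verts_daisy_cube finite_words)
  show "\<alpha> ` verts G \<subseteq> verts (daisy_cube h (\<alpha> ` verts G))"
    using assms(2) word_le_refl
    unfolding verts_daisy_cube proper_embedding_def isometric_embedding_def by blast
  show "card (\<alpha> ` verts G) = card (verts (daisy_cube h (\<alpha> ` verts G)))"
    unfolding card_image[OF assms(3)]
    using assms(2) by (intro card_verts_digraph_iso) (simp add: proper_embedding_def)
qed

lemma minimal_vertex_le_max_word: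
  assumes X: "X \<subseteq> words h" and minimal: "minimal_vertex h (daisy_cube h X) v"
    and x: "x \<in> max_words X"
  shows "word_le v x"
proof -
  let ?V = "verts (daisy_cube h X)"
  obtain \<alpha> where v: "v \<in> ?V" and \<alpha>: "proper_embedding h (daisy_cube h X) \<alpha>"
      and \<alpha>_v: "\<alpha> v = zero_word h"
    using minimal by (auto simp: minimal_vertex_def)
  have words: "u \<in> words h" if "u \<in> ?V" for u
    using that by (simp add: verts_daisy_cube)
  have \<alpha>_words: "\<alpha> u \<in> words h" if "u \<in> ?V" for u
    using that \<alpha> by (auto simp: proper_embedding_def isometric_embedding_def)
  have dist: "hamming (\<alpha> u) (\<alpha> w) = hamming u w" if "u \<in> ?V" "w \<in> ?V" for u w
    using that \<alpha> gdist_daisy_cube[OF X]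
    by (auto simp: proper_embedding_def isometric_embedding_def)
  have "inj_on \<alpha> ?V"
  proof (rule inj_onI)
    fix u w assume uw: "u \<in> ?V" "w \<in> ?V" "\<alpha> u = \<alpha> w"
    then have "hamming u w = 0"
      using dist[of u w] \<alpha>_words hamming_eq_0_iff[of "\<alpha> u" h "\<alpha> w"] by simp
    then show "u = w"
      using hamming_eq_0_iff[of u h w] words uw by simp
  qed
  moreover have fin: "finite ?V"
    by (simp add: verts_daisy_cube finite_words)
  ultimately have image: "\<alpha> ` ?V = verts (daisy_cube h (\<alpha> ` ?V))"
    using proper_embedding_image \<alpha> by blast
  have x_V: "x \<in> ?V"
    using max_words_in_verts[OF X x] .
  let ?B = "{u \<in> ?V. between h v u x}"
  let ?C = "{u \<in> words h. between h v u x}"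
  let ?B' = "{z \<in> words h. between h (zero_word h) z (\<alpha> x)}"
  \<comment> \<open>The image is a down-set containing \<open>\<alpha> x\<close>, so it contains
    \<open>?B'\<close>; isometry carries betweenness back to the daisy cube.\<close>
  have "?B' \<subseteq> \<alpha> ` ?B"
  proof
    fix z assume z: "z \<in> ?B'"
    then have "word_le z (\<alpha> x)"
      using \<alpha>_words[OF x_V] between_zero_iff by blast
    then have "z \<in> verts (daisy_cube h (\<alpha> ` ?V))"
      using z x_V by (auto simp: verts_daisy_cube[of h "\<alpha> ` _"])
    then obtain u where u: "u \<in> ?V" "z = \<alpha> u"
      using image by blast
    have "hamming (\<alpha> v) (\<alpha> u) + hamming (\<alpha> u) (\<alpha> x) = hamming (\<alpha> v) (\<alpha> x)"
      using z u \<alpha>_v hamming_add_eq_iff[of "\<alpha> v" h "\<alpha> u" "\<alpha> x"] \<alpha>_words v x_V by simp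
    then have "between h v u x"
      using hamming_add_eq_iff[of v h u x] words dist u v x_V by simp
    then show "z \<in> \<alpha> ` ?B"
      using u by blast
  qed
  then have "card ?B' \<le> card ?B"
    using fin by (intro surj_card_le) simp_all
  \<comment> \<open>Both are full hypercube intervals whose ends are equally far apart.\<close>
  moreover have "card ?B' = card ?C"
    using card_between[of "\<alpha> v" h "\<alpha> x"] card_between[of v h x] dist[OF v x_V] \<alpha>_v
      \<alpha>_words words v x_V by simp
  moreover have "?B \<subseteq> ?C" "finite ?C"
    using words by (auto simp: finite_words)
  ultimately have BC: "?B = ?C"
    using card_seteq[of ?C ?B] by simp
  \<comment> \<open>The join of \<open>v\<close> and \<open>x\<close>: each of its coordinates
    agrees with \<open>v\<close> or with \<open>x\<close>, so it lies in \<open>?C\<close>.\<close>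
  define j where "j = map (\<lambda>i. v ! i \<or> x ! i) [0..<h]"
  have j: "j \<in> words h" "\<And>i. i < h \<Longrightarrow> j ! i \<longleftrightarrow> v ! i \<or> x ! i"
    by (auto simp: j_def words_def)
  then have "j \<in> ?C"
    by (auto simp: between_def)
  then have "j \<in> ?V"
    using BC by blast
  then obtain y where y: "y \<in> X" "word_le j y"
    by (auto simp: verts_daisy_cube)
  have "y \<in> words h"
    using X y by blast
  then have "word_le x y" "word_le v y"
    using y j words[OF v] words[OF x_V] by (auto simp: word_le_iff[of _ h])
  \<comment> \<open>Maximality of \<open>x\<close> turns \<open>word_le x y\<close> into
    \<open>y = x\<close>.\<close>
  then show ?thesis
    using x y by (auto simp: max_words_def)
qed

theorem theorem1:
  fixes h :: nat and X :: "bword set"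
  assumes "X \<subseteq> words h"
  defines "G \<equiv> daisy_cube h X"
  defines "x_hat \<equiv> big_and h (max_words X)"
  defines "I \<equiv> verts G \<inter> (\<Inter>x\<in>max_words X. interval G (zero_word h) x)"
  shows "(\<forall>v\<in>verts G. minimal_vertex h G v \<longleftrightarrow> v \<in> I)
    \<and> I = interval G (zero_word h) x_hat"
proof -
  have I: "I = {v \<in> verts G. \<forall>x\<in>max_words X. word_le v x}"
    unfolding I_def G_def by (rule Inter_interval_max_words[OF assms(1)])
  moreover have "interval G (zero_word h) x_hat = {v \<in> verts G. \<forall>x\<in>max_words X. word_le v x}"
    unfolding G_def x_hat_def by (rule interval_big_and_max_words[OF assms(1)])
  moreover have "minimal_vertex h G v \<longleftrightarrow> v \<in> I" if "v \<in> verts G" for v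
    using that minimal_vertexI[OF assms(1)] minimal_vertex_le_max_word[OF assms(1)]
    by (auto simp: I G_def)
  ultimately show ?thesis
    by simp
qed

end
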